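(* Let $G=\langle V,E,L\rangle$ and $G'=\langle V',E',L'\rangle$ be finite fuzzy graphs. Algorithm A (described in the context), run on $G$ and $G'$ with any choices of iteration orders and of the pairs extracted from $R$, always terminates and returns the largest simulation between $G$ and $G'$.
   Context: A fuzzy graph over finite sets $\Sigma_V,\Sigma_E$ is $G=\langle V,E,L\rangle$ with $E: V\times\Sigma_E\times V\to[0,1]$, $L: V\to(\Sigma_V\to[0,1])$; $f\le g$ for $f,g:\Sigma_V\to[0,1]$ means pointwise. $Z\subseteq V\times V'$ (possibly empty) is a simulation between $G$ and $G'=\langle V',E',L'\rangle$ if for all $x,y\in V,x'\in V',r\in\Sigma_E$: $(x,x')\in Z$ implies $L(x)\le L'(x')$; and $(x,x')\in Z$, $E(x,r,y)>0$ imply there is $y'\in V'$ with $(y,y')\in Z$ and $E(x,r,y)\le E'(x',r,y')$. The largest simulation is the union of all simulations. Notation: $\mathrm{Prev}_r(y)=\{x\in V: E(x,r,y)>0\}$, $\mathrm{Next}'_r(x')=\{y'\in V':E'(x',r,y')>0\}$, $\mathrm{Prev}'_r(y')=\{x'\in V':E'(x',r,y')>0\}$; suprema are in $[0,1]$ with $\sup\emptyset=0$. Algorithm A maintains sets $Z,R\subseteq V\times V'$. Procedure ProcessPrev$(r,y,x')$: let $d=\sup\{E'(x',r,y')\mid y'\in\mathrm{Next}'_r(x'),\ (y,y')\in Z\cup R\}$; then for each $x\in\mathrm{Prev}_r(y)$, if $E(x,r,y)>d$ and $(x,x')\in Z$, remove $(x,x')$ from $Z$ and add it to $R$. Algorithm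 A: set $Z:=\{(x,x')\in V\times V'\mid L(x)\le L'(x')\}$ and $R:=\emptyset$; for each $(r,y,x')\in\Sigma_E\times V\times V'$ call ProcessPrev$(r,y,x')$; then while $R\neq\emptyset$: remove some pair $(y,y')$ from $R$, and for each $r\in\Sigma_E$ and $x'\in\mathrm{Prev}'_r(y')$ call ProcessPrev$(r,y,x')$; finally return $Z$. *)

theory Defs
  imports Complex_Main
begin

record ('v, 'l, 'e) fuzzy_graph =
  verts :: "'v set"
  edge :: "'v \<Rightarrow> 'e \<Rightarrow> 'v \<Rightarrow> real"
  label :: "'v \<Rightarrow> 'l \<Rightarrow> real"

text \<open>The values of \<open>edge\<close> and \<open>label\<close> outside the carrier sets are unconstrained and never used.\<close>

definition is_fuzzy_graph :: "'l set \<Rightarrow> 'e set \<Rightarrow> ('v, 'l, 'e) fuzzy_graph \<Rightarrow> bool" where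
  "is_fuzzy_graph \<Sigma>V \<Sigma>E G \<longleftrightarrow>
     finite \<Sigma>V \<and> finite \<Sigma>E \<and>
     (\<forall>x\<in>verts G. \<forall>r\<in>\<Sigma>E. \<forall>y\<in>verts G. edge G x r y \<in> {0..1}) \<and>
     (\<forall>x\<in>verts G. \<forall>l\<in>\<Sigma>V. label G x l \<in> {0..1})"

definition finite_fuzzy_graph :: "'l set \<Rightarrow> 'e set \<Rightarrow> ('v, 'l, 'e) fuzzy_graph \<Rightarrow> bool" where
  "finite_fuzzy_graph \<Sigma>V \<Sigma>E G \<longleftrightarrow> is_fuzzy_graph \<Sigma>V \<Sigma>E G \<and> finite (verts G)"

definition label_le :: "'l set \<Rightarrow> ('l \<Rightarrow> real) \<Rightarrow> ('l \<Rightarrow> real) \<Rightarrow> bool" where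
  "label_le \<Sigma>V f g \<longleftrightarrow> (\<forall>l\<in>\<Sigma>V. f l \<le> g l)"

definition is_simulation ::
  "'l set \<Rightarrow> 'e set \<Rightarrow> ('v, 'l, 'e) fuzzy_graph \<Rightarrow> ('w, 'l, 'e) fuzzy_graph \<Rightarrow> ('v \<times> 'w) set \<Rightarrow> bool"
where
  "is_simulation \<Sigma>V \<Sigma>E G G' Z \<longleftrightarrow>
     Z \<subseteq> verts G \<times> verts G' \<and>
     (\<forall>x\<in>verts G. \<forall>x'\<in>verts G'.
        (x, x') \<in> Z \<longrightarrow> label_le \<Sigma>V (label G x) (label G' x')) \<and>
     (\<forall>x\<in>verts G. \<forall>y\<in>verts G. \<forall>x'\<in>verts G'. \<forall>r\<in>\<Sigma>E.
        (x, x') \<in> Z \<and> edge G x r y > 0 \<longrightarrow>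
        (\<exists>y'\<in>verts G'. (y, y') \<in> Z \<and> edge G x r y \<le> edge G' x' r y'))"

definition largest_simulation ::
  "'l set \<Rightarrow> 'e set \<Rightarrow> ('v, 'l, 'e) fuzzy_graph \<Rightarrow> ('w, 'l, 'e) fuzzy_graph \<Rightarrow> ('v \<times> 'w) set"
where
  "largest_simulation \<Sigma>V \<Sigma>E G G' = \<Union> {Z. is_simulation \<Sigma>V \<Sigma>E G G' Z}"

lemma is_simulation_largest_simulation:
  "is_simulation \<Sigma>V \<Sigma>E G G' (largest_simulation \<Sigma>V \<Sigma>E G G')"
proof -
  have *: "\<exists>y'\<in>verts G'. (y, y') \<in> largest_simulation \<Sigma>V \<Sigma>E G G' \<and> edge G x r y \<le> edge G' x' r y'"
    if h: "is_simulation \<Sigma>V \<Sigma>E G G' Z" "(x, x') \<in> Z" "x \<in> verts G" "y \<in> verts G" "x' \<in> verts G'"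
      "r \<in> \<Sigma>E" "edge G x r y > 0" for Z x y x' r
  proof -
    obtain y' where "y' \<in> verts G'" "(y, y') \<in> Z" "edge G x r y \<le> edge G' x' r y'"
      using h unfolding is_simulation_def by meson
    then show ?thesis
      using h(1) unfolding largest_simulation_def by blast
  qed
  have "largest_simulation \<Sigma>V \<Sigma>E G G' \<subseteq> verts G \<times> verts G'"
    unfolding largest_simulation_def is_simulation_def by blast
  moreover have "label_le \<Sigma>V (label G x) (label G' x')"
    if "x \<in> verts G" "x' \<in> verts G'" "(x, x') \<in> largest_simulation \<Sigma>V \<Sigma>E G G'" for x x'
    using that unfolding largest_simulation_def is_simulation_def by blast
  moreover have "\<exists>Z. is_simulation \<Sigma>V \<Sigma>E G G' Z \<and> p \<in> Z"
    if "p \<in> largest_simulation \<Sigma>V \<Sigma>E G G'" for p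
    using that unfolding largest_simulation_def by blast
  ultimately show ?thesis
    unfolding is_simulation_def[of _ _ _ _ "largest_simulation \<Sigma>V \<Sigma>E G G'"] using * by meson
qed

definition Prev :: "('v, 'l, 'e) fuzzy_graph \<Rightarrow> 'e \<Rightarrow> 'v \<Rightarrow> 'v set" where
  "Prev G r y = {x \<in> verts G. edge G x r y > 0}"

definition Next :: "('v, 'l, 'e) fuzzy_graph \<Rightarrow> 'e \<Rightarrow> 'v \<Rightarrow> 'v set" where
  "Next G r x = {y \<in> verts G. edge G x r y > 0}"

text \<open>Supremum in the unit interval; \<open>Sup {}\<close> is unspecified on \<^typ>\<open>real\<close>.\<close>

definition sup01 :: "real set \<Rightarrow> real" where
  "sup01 A = (if A = {} then 0 else Sup A)"

text \<open>
  The algorithm is a nondeterministic transition system. A for-each loop carries the set of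
  elements it has still to visit and picks the next one arbitrarily.
  \<^item> \<open>Loop C Z R\<close>: between calls of ProcessPrev; \<open>C\<close> holds the argument triples
    \<open>(r, y, x')\<close> still to be processed by the current for-each loop. That loop is the
    initial one or the one in the body of the while loop; both continue with the test of the
    while loop once \<open>C\<close> is empty.
  \<^item> \<open>Proc r y x' d X C Z R\<close>: inside the call with arguments \<open>(r, y, x')\<close>, where \<open>d\<close> was
    computed on entry and \<open>X\<close> is the unvisited part of \<open>Prev G r y\<close>; \<open>C\<close> is the pending set
    of the calling loop.
\<close>

datatype ('v, 'w, 'e) config =
    Start
  | Loop "('e \<times> 'v \<times> 'w) set" "('v \<times> 'w) set" "('v \<times> 'w) set"
  | Proc 'e 'v 'w real "'v set" "('e \<times> 'v \<times> 'w) set" "('v \<times> 'w) set" "('v \<times> 'w) set"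
  | Return "('v \<times> 'w) set"

inductive step ::
  "'l set \<Rightarrow> 'e set \<Rightarrow> ('v, 'l, 'e) fuzzy_graph \<Rightarrow> ('w, 'l, 'e) fuzzy_graph \<Rightarrow>
   ('v, 'w, 'e) config \<Rightarrow> ('v, 'w, 'e) config \<Rightarrow> bool"
  for \<Sigma>V \<Sigma>E G G'
where
  start:
    "step \<Sigma>V \<Sigma>E G G' Start
       (Loop (\<Sigma>E \<times> verts G \<times> verts G')
          {(x, x') \<in> verts G \<times> verts G'. label_le \<Sigma>V (label G x) (label G' x')} {})"
| call:
    "\<lbrakk>(r, y, x') \<in> C;
      d = sup01 {edge G' x' r y' | y'. y' \<in> Next G' r x' \<and> (y, y') \<in> Z \<union> R}\<rbrakk> \<Longrightarrow>
     step \<Sigma>V \<Sigma>E G G' (Loop C Z R) (Proc r y x' d (Prev G r y) (C - {(r, y, x')}) Z R)"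
| move:
    "\<lbrakk>x \<in> X; edge G x r y > d; (x, x') \<in> Z\<rbrakk> \<Longrightarrow>
     step \<Sigma>V \<Sigma>E G G' (Proc r y x' d X C Z R)
       (Proc r y x' d (X - {x}) C (Z - {(x, x')}) (R \<union> {(x, x')}))"
| skip:
    "\<lbrakk>x \<in> X; \<not> (edge G x r y > d \<and> (x, x') \<in> Z)\<rbrakk> \<Longrightarrow>
     step \<Sigma>V \<Sigma>E G G' (Proc r y x' d X C Z R) (Proc r y x' d (X - {x}) C Z R)"
| leave:
    "step \<Sigma>V \<Sigma>E G G' (Proc r y x' d {} C Z R) (Loop C Z R)"
| pick:
    "(y, y') \<in> R \<Longrightarrow>
     step \<Sigma>V \<Sigma>E G G' (Loop {} Z R)
       (Loop {(r, y, x') | r x'. r \<in> \<Sigma>E \<and> x' \<in> Prev G' r y'} Z (R - {(y, y')}))"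
| finish:
    "step \<Sigma>V \<Sigma>E G G' (Loop {} Z {}) (Return Z)"

end

theory Submission
  imports Defs
begin

text \<open>
  Soundness: only pairs outside the largest simulation \<open>S\<close> ever leave \<open>Z\<close>, so \<open>S \<subseteq> Z\<close> throughout.
  Completeness: the transfer condition for a pair in \<open>Z\<close> always has a witness in \<open>Z \<union> R\<close>, except
  for triples \<open>(r, y, x')\<close> whose processing is still pending; picking a pair from \<open>R\<close> makes
  precisely the triples pending whose witness may be lost. When nothing is pending and \<open>R = {}\<close>,
  \<open>Z\<close> is therefore a simulation. The set \<open>Z \<union> R\<close> does not change during a call, so the bound
  \<open>d\<close> computed on entry stays valid. For termination, \<open>card Z + card R\<close> never increases
  and each pick decreases it.
\<close>

section \<open>Suprema of finite sets of edge values\<close>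

text \<open>A nonempty finite set attains its supremum. For the empty set the default value 0 makes
  both sides false, because \<open>e\<close> is positive.\<close>

lemma le_sup01_iff:
  assumes "finite A" "e > 0"
  shows "e \<le> sup01 A \<longleftrightarrow> (\<exists>a\<in>A. e \<le> a)"
proof (cases "A = {}")
  case True
  then show ?thesis using assms by (simp add: sup01_def)
next
  case False
  then have "sup01 A = Max A"
    using assms by (simp add: sup01_def cSup_eq_Max)
  then show ?thesis using False assms by (simp add: Max_ge_iff)
qed

definition succ_bound ::
  "('w, 'l, 'e) fuzzy_graph \<Rightarrow> 'e \<Rightarrow> 'v \<Rightarrow> 'w \<Rightarrow> ('v \<times> 'w) set \<Rightarrow> real"
where
  "succ_bound G' r y x' W = sup01 {edge G' x' r y' | y'. y' \<in> Next G' r x' \<and> (y, y') \<in> W}"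

text \<open>Restricting the supremum to \<open>Next\<close> loses no witness: an edge value above
  the positive \<open>e\<close> is itself positive.\<close>

lemma le_succ_bound_iff:
  assumes "finite (verts G')" "e > 0"
  shows "e \<le> succ_bound G' r y x' W \<longleftrightarrow> (\<exists>y'\<in>verts G'. (y, y') \<in> W \<and> e \<le> edge G' x' r y')"
proof -
  let ?A = "{edge G' x' r y' | y'. y' \<in> Next G' r x' \<and> (y, y') \<in> W}"
  have "finite ?A"
    using assms(1) by (auto simp: Next_def)
  then show ?thesis
    using assms(2) unfolding succ_bound_def
    by (subst le_sup01_iff) (fastforce simp: Next_def)+
qed

section \<open>The invariant\<close>

text \<open>The transfer clause of a simulation, weakened twice: witnesses may come from
  \<open>W\<close> instead of \<open>Z\<close>, and \<open>P\<close> lists exemptions.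
  \<open>P\<close> depends on the source \<open>x\<close> too, since inside a call the predecessors
  are settled one at a time.\<close>

definition transfer_except ::
  "'e set \<Rightarrow> ('v, 'l, 'e) fuzzy_graph \<Rightarrow> ('w, 'l, 'e) fuzzy_graph \<Rightarrow>
   ('v \<Rightarrow> 'e \<Rightarrow> 'v \<Rightarrow> 'w \<Rightarrow> bool) \<Rightarrow> ('v \<times> 'w) set \<Rightarrow> ('v \<times> 'w) set \<Rightarrow> bool"
where
  "transfer_except \<Sigma>E G G' P Z W \<longleftrightarrow>
     (\<forall>x x' r y. (x, x') \<in> Z \<longrightarrow> r \<in> \<Sigma>E \<longrightarrow> y \<in> verts G \<longrightarrow> edge G x r y > 0 \<longrightarrow>
        P x r y x' \<or> (\<exists>y'\<in>verts G'. (y, y') \<in> W \<and> edge G x r y \<le> edge G' x' r y'))"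

definition state_ok ::
  "'l set \<Rightarrow> 'e set \<Rightarrow> ('v, 'l, 'e) fuzzy_graph \<Rightarrow> ('w, 'l, 'e) fuzzy_graph \<Rightarrow>
   ('e \<times> 'v \<times> 'w) set \<Rightarrow> ('v \<times> 'w) set \<Rightarrow> ('v \<times> 'w) set \<Rightarrow> bool"
where
  "state_ok \<Sigma>V \<Sigma>E G G' C Z R \<longleftrightarrow>
     C \<subseteq> \<Sigma>E \<times> verts G \<times> verts G' \<and>
     Z \<subseteq> verts G \<times> verts G' \<and> R \<subseteq> verts G \<times> verts G' \<and>
     (\<forall>(x, x')\<in>Z. label_le \<Sigma>V (label G x) (label G' x')) \<and>
     largest_simulation \<Sigma>V \<Sigma>E G G' \<subseteq> Z"

text \<open>During a call the current triple has left \<open>C\<close>, so its exemption survives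
  only for the unvisited sources in \<open>X\<close>. The equation for \<open>d\<close> refers to
  the current \<open>Z\<close> and \<open>R\<close>, not to those at entry.\<close>

fun invariant ::
  "'l set \<Rightarrow> 'e set \<Rightarrow> ('v, 'l, 'e) fuzzy_graph \<Rightarrow> ('w, 'l, 'e) fuzzy_graph \<Rightarrow>
   ('v, 'w, 'e) config \<Rightarrow> bool"
where
  "invariant \<Sigma>V \<Sigma>E G G' Start \<longleftrightarrow> True"
| "invariant \<Sigma>V \<Sigma>E G G' (Loop C Z R) \<longleftrightarrow>
     state_ok \<Sigma>V \<Sigma>E G G' C Z R \<and>
     transfer_except \<Sigma>E G G' (\<lambda>x r y x'. (r, y, x') \<in> C) Z (Z \<union> R)"
| "invariant \<Sigma>V \<Sigma>E G G' (Proc r y x' d X C Z R) \<longleftrightarrow>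
     state_ok \<Sigma>V \<Sigma>E G G' C Z R \<and> r \<in> \<Sigma>E \<and> y \<in> verts G \<and> x' \<in> verts G' \<and>
     X \<subseteq> Prev G r y \<and> d = succ_bound G' r y x' (Z \<union> R) \<and>
     transfer_except \<Sigma>E G G'
       (\<lambda>z s v z'. (s, v, z') \<in> C \<or> (s, v, z') = (r, y, x') \<and> z \<in> X) Z (Z \<union> R)"
| "invariant \<Sigma>V \<Sigma>E G G' (Return Z) \<longleftrightarrow> Z = largest_simulation \<Sigma>V \<Sigma>E G G'"

section \<open>Preservation of the invariant\<close>

lemma is_simulation_subset_largest:
  "is_simulation \<Sigma>V \<Sigma>E G G' Z \<Longrightarrow> Z \<subseteq> largest_simulation \<Sigma>V \<Sigma>E G G'"
  unfolding largest_simulation_def by blast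

text \<open>The largest simulation is itself a simulation, so it supplies a witness lying in
  \<open>W\<close>. Read contrapositively, an edge value above the bound justifies discarding the
  pair.\<close>

lemma largest_simulation_edge_le_bound:
  assumes "(x, x') \<in> largest_simulation \<Sigma>V \<Sigma>E G G'" "largest_simulation \<Sigma>V \<Sigma>E G G' \<subseteq> W"
    and "finite (verts G')" "r \<in> \<Sigma>E" "y \<in> verts G" "edge G x r y > 0"
  shows "edge G x r y \<le> succ_bound G' r y x' W"
proof -
  have sim: "is_simulation \<Sigma>V \<Sigma>E G G' (largest_simulation \<Sigma>V \<Sigma>E G G')"
    by (rule is_simulation_largest_simulation)
  then have "x \<in> verts G" "x' \<in> verts G'"
    using assms(1) unfolding is_simulation_def by auto
  then obtain y' where "y' \<in> verts G'" "(y, y') \<in> largest_simulation \<Sigma>V \<Sigma>E G G'"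
      "edge G x r y \<le> edge G' x' r y'"
    using sim assms unfolding is_simulation_def by meson
  then show ?thesis
    using assms by (subst le_succ_bound_iff) auto
qed

lemma invariant_step:
  assumes "step \<Sigma>V \<Sigma>E G G' c c'" "invariant \<Sigma>V \<Sigma>E G G' c" "finite (verts G')"
  shows "invariant \<Sigma>V \<Sigma>E G G' c'"
  using assms(1,2)
proof cases
  case start
  have "largest_simulation \<Sigma>V \<Sigma>E G G'
      \<subseteq> {(x, x') \<in> verts G \<times> verts G'. label_le \<Sigma>V (label G x) (label G' x')}"
    using is_simulation_largest_simulation[of \<Sigma>V \<Sigma>E G G'] unfolding is_simulation_def by auto
  \<comment> \<open>Every triple is pending, so every transfer obligation is exempt.\<close>
  then show ?thesis
    unfolding start by (auto simp: state_ok_def transfer_except_def)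
next
  case (call r y x' C d Z R)
  from assms(2) have ok: "state_ok \<Sigma>V \<Sigma>E G G' C Z R"
    and tr: "transfer_except \<Sigma>E G G' (\<lambda>x r y x'. (r, y, x') \<in> C) Z (Z \<union> R)"
    unfolding call by auto
  \<comment> \<open>The exemption of the called triple passes from \<open>C\<close> to the sources
    in \<open>Prev G r y\<close>, which are all those with a positive edge.\<close>
  have "transfer_except \<Sigma>E G G'
       (\<lambda>z s v z'. (s, v, z') \<in> C - {(r, y, x')} \<or> (s, v, z') = (r, y, x') \<and> z \<in> Prev G r y) Z (Z \<union> R)"
    using tr ok unfolding transfer_except_def state_ok_def Prev_def by blast
  moreover have "state_ok \<Sigma>V \<Sigma>E G G' (C - {(r, y, x')}) Z R"
    using ok unfolding state_ok_def by auto
  moreover have "r \<in> \<Sigma>E" "y \<in> verts G" "x' \<in> verts G'"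
    using ok call(3) unfolding state_ok_def by auto
  ultimately show ?thesis
    using call(4) unfolding call(2) invariant.simps succ_bound_def by blast
next
  case (move x X r y d x' Z C R)
  \<comment> \<open>The pair only changes sides, so both the available witnesses and the value
    \<open>d\<close> persist.\<close>
  have un: "Z - {(x, x')} \<union> (R \<union> {(x, x')}) = Z \<union> R"
    using move by auto
  from assms(2) have ok: "state_ok \<Sigma>V \<Sigma>E G G' C Z R"
    and d: "r \<in> \<Sigma>E" "y \<in> verts G" "X \<subseteq> Prev G r y" "d = succ_bound G' r y x' (Z \<union> R)"
    and tr: "transfer_except \<Sigma>E G G'
       (\<lambda>z s v z'. (s, v, z') \<in> C \<or> (s, v, z') = (r, y, x') \<and> z \<in> X) Z (Z \<union> R)"
    unfolding move by auto
  have "edge G x r y > 0"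
    using d move by (auto simp: Prev_def)
  then have "(x, x') \<notin> largest_simulation \<Sigma>V \<Sigma>E G G'"
    using largest_simulation_edge_le_bound[of x x' \<Sigma>V \<Sigma>E G G' "Z \<union> R" r y] d ok move assms(3)
    unfolding state_ok_def by force
  then have "state_ok \<Sigma>V \<Sigma>E G G' C (Z - {(x, x')}) (R \<union> {(x, x')})"
    using ok move(5) unfolding state_ok_def by auto
  \<comment> \<open>The obligation at \<open>x\<close> disappears together with the pair, so
    \<open>x\<close> may leave the exempt set.\<close>
  moreover have "transfer_except \<Sigma>E G G'
       (\<lambda>z s v z'. (s, v, z') \<in> C \<or> (s, v, z') = (r, y, x') \<and> z \<in> X - {x})
       (Z - {(x, x')}) (Z \<union> R)"
    using tr unfolding transfer_except_def by blast
  ultimately show ?thesis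
    using assms(2) unfolding move(1,2) invariant.simps un by blast
next
  case (skip x X r y d x' Z C R)
  from assms(2) have d: "d = succ_bound G' r y x' (Z \<union> R)"
    and tr: "transfer_except \<Sigma>E G G'
       (\<lambda>z s v z'. (s, v, z') \<in> C \<or> (s, v, z') = (r, y, x') \<and> z \<in> X) Z (Z \<union> R)"
    unfolding skip by auto
  \<comment> \<open>If the pair stays in \<open>Z\<close>, the failed test means that the edge value
    is at most \<open>d\<close>, and the supremum is attained by a witness.\<close>
  have "\<exists>y'\<in>verts G'. (y, y') \<in> Z \<union> R \<and> edge G x r y \<le> edge G' x' r y'"
    if "(x, x') \<in> Z" "edge G x r y > 0"
  proof -
    have "edge G x r y \<le> succ_bound G' r y x' (Z \<union> R)"
      using that skip d by auto
    then show ?thesis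
      using that assms(3) by (subst (asm) le_succ_bound_iff)
  qed
  then have "transfer_except \<Sigma>E G G'
       (\<lambda>z s v z'. (s, v, z') \<in> C \<or> (s, v, z') = (r, y, x') \<and> z \<in> X - {x}) Z (Z \<union> R)"
    using tr unfolding transfer_except_def by blast
  then show ?thesis
    using assms(2) unfolding skip(1,2) invariant.simps by blast
next
  case leave
  then show ?thesis using assms(2) by simp
next
  case (pick y y' R Z)
  let ?C = "{(r, y, x') | r x'. r \<in> \<Sigma>E \<and> x' \<in> Prev G' r y'}"
  from assms(2) have ok: "state_ok \<Sigma>V \<Sigma>E G G' {} Z R"
    and tr: "transfer_except \<Sigma>E G G' (\<lambda>_ _ _ _. False) Z (Z \<union> R)"
    unfolding pick by auto
  have "transfer_except \<Sigma>E G G' (\<lambda>z s v z'. (s, v, z') \<in> ?C) Z (Z \<union> (R - {(y, y')}))"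
    unfolding transfer_except_def
  proof (intro allI impI)
    fix z z' s v
    assume z: "(z, z') \<in> Z" "s \<in> \<Sigma>E" "v \<in> verts G" "edge G z s v > 0"
    then obtain v' where v': "v' \<in> verts G'" "(v, v') \<in> Z \<union> R" "edge G z s v \<le> edge G' z' s v'"
      using tr unfolding transfer_except_def by meson
    \<comment> \<open>The witness edge dominates a positive value. Hence, if the witness is the
      extracted pair, the triple is among those made pending.\<close>
    have "z' \<in> Prev G' s v'"
      using z v' ok unfolding state_ok_def Prev_def by auto
    then show "(s, v, z') \<in> ?C \<or>
        (\<exists>v'\<in>verts G'. (v, v') \<in> Z \<union> (R - {(y, y')}) \<and> edge G z s v \<le> edge G' z' s v')"
      using v' z by (cases "(v, v') = (y, y')") auto
  qed
  moreover have "state_ok \<Sigma>V \<Sigma>E G G' ?C Z (R - {(y, y')})"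
    using ok pick(3) unfolding state_ok_def Prev_def by auto
  ultimately show ?thesis
    unfolding pick(2) by simp
next
  case (finish Z)
  then have ok: "state_ok \<Sigma>V \<Sigma>E G G' {} Z {}"
    and tr: "transfer_except \<Sigma>E G G' (\<lambda>_ _ _ _. False) Z Z"
    using assms(2) by auto
  have "is_simulation \<Sigma>V \<Sigma>E G G' Z"
    using ok tr unfolding is_simulation_def state_ok_def transfer_except_def by auto
  then have "Z \<subseteq> largest_simulation \<Sigma>V \<Sigma>E G G'"
    by (rule is_simulation_subset_largest)
  then show ?thesis
    using ok unfolding finish state_ok_def by auto
qed

lemma invariant_reachable:
  assumes "(step \<Sigma>V \<Sigma>E G G')\<^sup>*\<^sup>* Start c" "finite (verts G')"
  shows "invariant \<Sigma>V \<Sigma>E G G' c"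
  using assms(1)
proof induction
  case (step c c')
  then show ?case using invariant_step assms(2) by blast
qed simp

section \<open>Absence of deadlock and termination\<close>

text \<open>The rules cover all cases: a nonempty \<open>C\<close> permits a call, an empty one a
  pick or the finish, and \<open>move\<close> and \<open>skip\<close> have complementary
  guards.\<close>

lemma stuck_is_Return:
  assumes "\<nexists>c'. step \<Sigma>V \<Sigma>E G G' c c'"
  shows "\<exists>Z. c = Return Z"
proof (cases c)
  case Start
  then show ?thesis using assms step.start by blast
next
  case (Loop C Z R)
  have "C = {}"
    using assms step.call unfolding Loop by fast
  moreover from this have "R = {}"
    using assms step.pick unfolding Loop by fast
  ultimately show ?thesis
    using assms step.finish unfolding Loop by blast
next
  case (Proc r y x' d X C Z R)
  have "x \<notin> X" for x
    using assms step.move[of x X d G r y x' Z \<Sigma>V \<Sigma>E G' C R]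
      step.skip[of x X d G r y x' Z \<Sigma>V \<Sigma>E G' C R] unfolding Proc by blast
  then have "X = {}"
    by blast
  then show ?thesis
    using assms step.leave[of \<Sigma>V \<Sigma>E G G' r y x' d C Z R] Proc by blast
qed blast

fun phase :: "('v, 'w, 'e) config \<Rightarrow> nat" where
  "phase Start = 2"
| "phase (Loop C Z R) = 1"
| "phase (Proc r y x' d X C Z R) = 1"
| "phase (Return Z) = 0"

fun live_pairs :: "('v, 'w, 'e) config \<Rightarrow> nat" where
  "live_pairs (Loop C Z R) = card Z + card R"
| "live_pairs (Proc r y x' d X C Z R) = card Z + card R"
| "live_pairs _ = 0"

text \<open>Refilled by a pick, which is paid for by \<open>live_pairs\<close>.\<close>

fun pending_calls :: "('v, 'w, 'e) config \<Rightarrow> nat" where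
  "pending_calls (Loop C Z R) = card C"
| "pending_calls (Proc r y x' d X C Z R) = card C"
| "pending_calls _ = 0"

text \<open>\<open>Suc\<close> keeps a call with nothing left to visit above the \<open>Loop\<close>
  to which it returns, whose value is 0.\<close>

fun pending_visits :: "('v, 'w, 'e) config \<Rightarrow> nat" where
  "pending_visits (Proc r y x' d X C Z R) = Suc (card X)"
| "pending_visits _ = 0"

text \<open>The order of the measures matters: \<open>phase\<close> handles start and finish, and a
  call lowers \<open>pending_calls\<close> while opening new visits.\<close>

definition progress :: "(('v, 'w, 'e) config \<times> ('v, 'w, 'e) config) set" where
  "progress = measures [phase, live_pairs, pending_calls, pending_visits]"

lemma step_progress:
  assumes "step \<Sigma>V \<Sigma>E G G' c c'" "invariant \<Sigma>V \<Sigma>E G G' c"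
    and fin: "finite (verts G)" "finite (verts G')" "finite \<Sigma>E"
  shows "(c', c) \<in> progress"
proof -
  have state_fin: "finite C \<and> finite Z \<and> finite R" if "state_ok \<Sigma>V \<Sigma>E G G' C Z R" for C Z R
    using that fin unfolding state_ok_def by (meson finite_SigmaI finite_subset)
  have Prev_fin: "finite X" if "X \<subseteq> Prev G r y" for X r y
    using that fin(1) unfolding Prev_def by (auto intro: finite_subset)
  show ?thesis
    using assms(1)
  proof cases
    case start
    then show ?thesis by (simp add: progress_def)
  next
    case (call r y x' C d Z R)
    then have "finite C"
      using assms(2) by (auto dest: state_fin)
    then have "card (C - {(r, y, x')}) < card C"
      using call(3) by (rule card_Diff1_less)
    with call show ?thesis by (simp add: progress_def)
  next
    case (move x X r y d x' Z C R)
    then have "finite X" "finite Z"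
      using assms(2) by (auto dest: state_fin Prev_fin)
    then have "card (X - {x}) < card X" "Suc (card (Z - {(x, x')})) = card Z"
      using card_Diff1_less[of X x] card_Suc_Diff1[of Z "(x, x')"] move(3,5) by blast+
    \<comment> \<open>The invariant does not record that \<open>Z\<close> and \<open>R\<close> are
      disjoint, so \<open>live_pairs\<close> is only shown not to grow; if it is unchanged, the
      visit count decides.\<close>
    moreover have "card (R \<union> {(x, x')}) \<le> Suc (card R)"
      using card_Un_le[of R "{(x, x')}"] by simp
    ultimately show ?thesis unfolding move(1,2) progress_def in_measures
      by (simp del: Un_insert_right) linarith
  next
    case (skip x X r y d x' Z C R)
    then have "finite X"
      using assms(2) by (auto dest: Prev_fin)
    then have "card (X - {x}) < card X"
      using skip(3) by (rule card_Diff1_less)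
    with skip show ?thesis by (simp add: progress_def)
  next
    case leave
    then show ?thesis by (simp add: progress_def)
  next
    case (pick y y' R Z)
    then have "finite R"
      using assms(2) by (auto dest: state_fin)
    then have "card (R - {(y, y')}) < card R"
      using pick(3) by (rule card_Diff1_less)
    with pick show ?thesis by (simp add: progress_def)
  next
    case finish
    then show ?thesis by (simp add: progress_def)
  qed
qed

theorem theorem1:
  fixes \<Sigma>V :: "'l set" and \<Sigma>E :: "'e set"
    and G :: "('v, 'l, 'e) fuzzy_graph" and G' :: "('w, 'l, 'e) fuzzy_graph"
  assumes "finite_fuzzy_graph \<Sigma>V \<Sigma>E G"
    and "finite_fuzzy_graph \<Sigma>V \<Sigma>E G'"
  shows "(\<nexists>\<rho> :: nat \<Rightarrow> ('v, 'w, 'e) config.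
            \<rho> 0 = Start \<and> (\<forall>i. step \<Sigma>V \<Sigma>E G G' (\<rho> i) (\<rho> (Suc i)))) \<and>
         (\<forall>c :: ('v, 'w, 'e) config.
            (step \<Sigma>V \<Sigma>E G G')\<^sup>*\<^sup>* Start c \<and> (\<nexists>c'. step \<Sigma>V \<Sigma>E G G' c c') \<longrightarrow>
            c = Return (largest_simulation \<Sigma>V \<Sigma>E G G'))"
proof (intro conjI allI impI notI)
  have fin: "finite (verts G)" "finite (verts G')" "finite \<Sigma>E"
    using assms unfolding finite_fuzzy_graph_def is_fuzzy_graph_def by auto
  {
    assume "\<exists>\<rho> :: nat \<Rightarrow> ('v, 'w, 'e) config.
      \<rho> 0 = Start \<and> (\<forall>i. step \<Sigma>V \<Sigma>E G G' (\<rho> i) (\<rho> (Suc i)))"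
    then obtain \<rho> :: "nat \<Rightarrow> ('v, 'w, 'e) config"
      where \<rho>: "\<rho> 0 = Start" "\<And>i. step \<Sigma>V \<Sigma>E G G' (\<rho> i) (\<rho> (Suc i))"
      by blast
    have "(step \<Sigma>V \<Sigma>E G G')\<^sup>*\<^sup>* Start (\<rho> i)" for i
      by (induction i) (auto simp: \<rho>(1) intro: rtranclp.rtrancl_into_rtrancl \<rho>(2))
    \<comment> \<open>The decrease relies on the invariant, which reachability provides along the
      whole run.\<close>
    then have "(\<rho> (Suc i), \<rho> i) \<in> progress" for i
      using step_progress invariant_reachable \<rho>(2) fin by blast
    moreover have "wf (progress :: (('v, 'w, 'e) config \<times> ('v, 'w, 'e) config) set)"
      unfolding progress_def by (rule wf_measures)
    ultimately show False
      unfolding wf_iff_no_infinite_down_chain by blast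
  next
    fix c :: "('v, 'w, 'e) config"
    assume "(step \<Sigma>V \<Sigma>E G G')\<^sup>*\<^sup>* Start c \<and> (\<nexists>c'. step \<Sigma>V \<Sigma>E G G' c c')"
    then have "invariant \<Sigma>V \<Sigma>E G G' c" "\<exists>Z. c = Return Z"
      using invariant_reachable[of \<Sigma>V \<Sigma>E G G' c] fin(2) stuck_is_Return[of \<Sigma>V \<Sigma>E G G' c] by simp_all
    then show "c = Return (largest_simulation \<Sigma>V \<Sigma>E G G')"
      by auto
  }
qed

end
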